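(* Let $\mathcal{H}$ be a finite-dimensional complex Hilbert space, let $\mathcal{D}(\mathcal{H})$ be the set of density operators on $\mathcal{H}$, and let $\mathcal{C}(\mathcal{H})\subseteq\mathcal{D}(\mathcal{H})$ be a convex subset. If $\rho\in\mathcal{C}(\mathcal{H})$ has the maximal lexicographic spectrum among all states in $\mathcal{C}(\mathcal{H})$ (that is, $\mathrm{Spec}\,\sigma\le\mathrm{Spec}\,\rho$ in lexicographic order for every $\sigma\in\mathcal{C}(\mathcal{H})$), then $\rho$ is an extreme point of $\mathcal{C}(\mathcal{H})$.
   Context: A density operator (state) on $\mathcal{H}$ is a positive semidefinite linear operator on $\mathcal{H}$ of trace $1$. $\mathrm{Spec}\,\rho=(r_1,\dots,r_d)$, $d=\dim\mathcal{H}$, is the vector of eigenvalues of $\rho$ (with multiplicity) in decreasing order $r_1\ge\dots\ge r_d$. Lexicographic order: $x$ is less than $y$ if for some index $i$, $x_j=y_j$ for all $j<i$ and $x_i<y_i$; $x\le y$ means less than or equal. *)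

theory Defs
  imports "HOL-Analysis.Analysis"
begin

text \<open>
  A complex inner product space is a real inner product space with a compatible complex scalar
  multiplication and a sesquilinear form (antilinear in the first argument) whose real part is
  the given real inner product; in particular the norm is the one induced by \<open>cinner\<close>.
  The finite-dimensional complex Hilbert spaces of positive dimension are then the types of sort
  \<open>{complex_inner, euclidean_space}\<close>: finite-dimensionality over the reals and over the complex
  numbers coincide, and completeness is automatic.
\<close>

class complex_inner = real_inner +
  fixes scaleC :: "complex \<Rightarrow> 'a \<Rightarrow> 'a"  (infixr \<open>*\<^sub>C\<close> 75)
    and cinner :: "'a \<Rightarrow> 'a \<Rightarrow> complex"
  assumes scaleC_add_right: "c *\<^sub>C (x + y) = c *\<^sub>C x + c *\<^sub>C y"
    and scaleC_add_left: "(c + d) *\<^sub>C x = c *\<^sub>C x + d *\<^sub>C x"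
    and scaleC_scaleC: "c *\<^sub>C d *\<^sub>C x = (c * d) *\<^sub>C x"
    and scaleC_of_real: "complex_of_real r *\<^sub>C x = r *\<^sub>R x"
    and cinner_commute: "cinner x y = cnj (cinner y x)"
    and cinner_add_right: "cinner x (y + z) = cinner x y + cinner x z"
    and cinner_scaleC_right: "cinner x (c *\<^sub>C y) = c * cinner x y"
    and Re_cinner: "Re (cinner x y) = inner x y"

global_interpretation complex_vector:
  vector_space "scaleC :: complex \<Rightarrow> 'a \<Rightarrow> 'a::complex_inner"
  defines cspan = complex_vector.span
    and cdim = complex_vector.dim
proof
  fix c d :: complex and x y :: 'a
  show "c *\<^sub>C (x + y) = c *\<^sub>C x + c *\<^sub>C y" by (rule scaleC_add_right)
  show "(c + d) *\<^sub>C x = c *\<^sub>C x + d *\<^sub>C x" by (rule scaleC_add_left)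
  show "c *\<^sub>C d *\<^sub>C x = (c * d) *\<^sub>C x" by (rule scaleC_scaleC)
  show "1 *\<^sub>C x = x" using scaleC_of_real[of 1 x] by simp
qed

instantiation complex :: complex_inner
begin
definition "c *\<^sub>C (x::complex) = c * x"
definition "cinner (x::complex) y = cnj x * y"
instance
  by standard
    (simp_all add: scaleC_complex_def cinner_complex_def inner_complex_def algebra_simps
      scaleR_conv_of_real)
end

instantiation vec :: (complex_inner, finite) complex_inner
begin
definition "c *\<^sub>C (x::'a^'b) = (\<chi> i. c *\<^sub>C (x $ i))"
definition "cinner (x::'a^'b) y = (\<Sum>i\<in>UNIV. cinner (x $ i) (y $ i))"
instance
proof
  fix c d :: complex and r :: real and x y z :: "'a^'b"
  show "c *\<^sub>C (x + y) = c *\<^sub>C x + c *\<^sub>C y"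
    by (simp add: scaleC_vec_def vec_eq_iff scaleC_add_right)
  show "(c + d) *\<^sub>C x = c *\<^sub>C x + d *\<^sub>C x"
    by (simp add: scaleC_vec_def vec_eq_iff scaleC_add_left)
  show "c *\<^sub>C d *\<^sub>C x = (c * d) *\<^sub>C x"
    by (simp add: scaleC_vec_def vec_eq_iff scaleC_scaleC)
  show "complex_of_real r *\<^sub>C x = r *\<^sub>R x"
    by (simp add: scaleC_vec_def vec_eq_iff scaleC_of_real)
  show "cinner x y = cnj (cinner y x)"
    unfolding cinner_vec_def cnj_sum by (rule sum.cong[OF refl]) (rule cinner_commute)
  show "cinner x (y + z) = cinner x y + cinner x z"
    by (simp add: cinner_vec_def cinner_add_right sum.distrib)
  show "cinner x (c *\<^sub>C y) = c * cinner x y"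
    by (simp add: cinner_vec_def scaleC_vec_def cinner_scaleC_right sum_distrib_left)
  show "Re (cinner x y) = inner x y"
    by (simp add: cinner_vec_def inner_vec_def Re_cinner)
qed
end

definition orthonormal_basis :: "'a::complex_inner set \<Rightarrow> bool" where
  "orthonormal_basis B \<longleftrightarrow>
     finite B \<and> (\<forall>x\<in>B. \<forall>y\<in>B. cinner x y = (if x = y then 1 else 0)) \<and> cspan B = UNIV"

text \<open>
  Linear operators are elements of \<^typ>\<open>'a \<Rightarrow>\<^sub>L 'a\<close> that are in addition complex homogeneous;
  boundedness is automatic in finite dimension. This type provides the real vector space in
  which convexity and extreme points are taken.
\<close>

definition complex_linear :: "('a::complex_inner \<Rightarrow>\<^sub>L 'a) \<Rightarrow> bool" where
  "complex_linear A \<longleftrightarrow> (\<forall>c x. A (c *\<^sub>C x) = c *\<^sub>C A x)"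

definition positive_semidefinite :: "('a::complex_inner \<Rightarrow>\<^sub>L 'a) \<Rightarrow> bool" where
  "positive_semidefinite A \<longleftrightarrow> (\<forall>x. cinner x (A x) \<in> \<real>\<^sub>\<ge>\<^sub>0)"

text \<open>The choice of the basis is immaterial: see \<open>ex_orthonormal_basis\<close> and \<open>op_trace_eq\<close> below.\<close>

definition op_trace :: "('a::complex_inner \<Rightarrow>\<^sub>L 'a) \<Rightarrow> complex" where
  "op_trace A = (\<Sum>b\<in>(SOME B. orthonormal_basis B). cinner b (A b))"

definition density_operators :: "('a::{complex_inner, euclidean_space} \<Rightarrow>\<^sub>L 'a) set" where
  "density_operators = {A. complex_linear A \<and> positive_semidefinite A \<and> op_trace A = 1}"

definition eigenspace :: "('a::complex_inner \<Rightarrow>\<^sub>L 'a) \<Rightarrow> complex \<Rightarrow> 'a set" where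
  "eigenspace A c = {x. A x = c *\<^sub>C x}"

text \<open>
  \<open>Spec A\<close> lists the real eigenvalues of \<open>A\<close> in decreasing order, each repeated according to its
  multiplicity (the complex dimension of the eigenspace). It is meant for positive semidefinite
  \<open>A\<close>: all eigenvalues are then real, and the length of the list is the complex dimension of the
  space.
\<close>

definition real_eigenvalues :: "('a::complex_inner \<Rightarrow>\<^sub>L 'a) \<Rightarrow> real set" where
  "real_eigenvalues A = {r. \<exists>x. x \<noteq> 0 \<and> x \<in> eigenspace A (complex_of_real r)}"

definition Spec :: "('a::complex_inner \<Rightarrow>\<^sub>L 'a) \<Rightarrow> real list" where
  "Spec A = concat (map (\<lambda>r. replicate (cdim (eigenspace A (complex_of_real r))) r)
     (rev (sorted_list_of_set (real_eigenvalues A))))"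

definition lex_le :: "real list \<Rightarrow> real list \<Rightarrow> bool"  (infix \<open>\<le>\<^sub>l\<^sub>e\<^sub>x\<close> 50) where
  "xs \<le>\<^sub>l\<^sub>e\<^sub>x ys \<longleftrightarrow> xs = ys \<or> (xs, ys) \<in> lex {(a, b). a < b}"


subsection \<open>The trace does not depend on the basis\<close>

lemma cinner_add_left: "cinner (x + y) z = cinner x z + cinner y (z::'a::complex_inner)"
  by (metis cinner_add_right cinner_commute complex_cnj_add)

lemma cinner_scaleC_left: "cinner (c *\<^sub>C x) y = cnj c * cinner x (y::'a::complex_inner)"
  by (metis cinner_commute cinner_scaleC_right complex_cnj_mult)

lemma cinner_zero_right [simp]: "cinner x (0::'a::complex_inner) = 0"
  using cinner_add_right[of x 0 0] by simp

lemma cinner_sum_right: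
  "cinner x (\<Sum>i\<in>I. f i) = (\<Sum>i\<in>I. cinner x (f i :: 'a::complex_inner))"
  by (induction I rule: infinite_finite_induct) (simp_all add: cinner_add_right)

lemma cinner_diff_right: "cinner x (y - z) = cinner x y - cinner x (z::'a::complex_inner)"
  by (metis add_diff_cancel_right' cinner_add_right diff_add_cancel)

lemma cinner_self: "cinner x (x::'a::complex_inner) = complex_of_real ((norm x)\<^sup>2)"
proof -
  have "Im (cinner x x) = 0"
    using arg_cong[OF cinner_commute[of x x], of Im] by simp
  then show ?thesis
    by (simp add: complex_eq_iff Re_cinner power2_norm_eq_inner)
qed

lemma ex_orthonormal_basis: "\<exists>B::'a::{complex_inner, euclidean_space} set. orthonormal_basis B"
proof -
  define on where "on B \<longleftrightarrow> (\<forall>x\<in>B. \<forall>y\<in>B. cinner x y = (if x = y then 1 else 0))" for B :: "'a set"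
  have card: "finite B \<and> card B \<le> DIM('a)" if "on B" for B
  proof -
    have "pairwise orthogonal B"
      using that unfolding pairwise_def orthogonal_def on_def by (metis Re_cinner zero_complex.sel(1))
    moreover have "0 \<notin> B" using that unfolding on_def by (metis cinner_zero_right zero_neq_one)
    ultimately have "independent B" by (rule pairwise_orthogonal_independent)
    then show ?thesis by (rule independent_bound)
  qed
  have "on {}" by (simp add: on_def)
  then obtain B where B: "on B" and max: "\<And>B'. on B' \<Longrightarrow> card B' \<le> card B"
    using ex_has_greatest_nat[of on "{}" card "Suc DIM('a)"] card le_imp_less_Suc by metis
  have fin: "finite B" using card[OF B] by simp
  have "x \<in> cspan B" for x
  proof (rule ccontr)
    assume x: "x \<notin> cspan B"
    define p where "p = (\<Sum>b\<in>B. cinner b x *\<^sub>C b)"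
    have p: "p \<in> cspan B"
      unfolding p_def
      by (rule complex_vector.span_sum, rule complex_vector.span_scale, rule complex_vector.span_base)
    define y where "y = x - p"
    have "y \<noteq> 0" using x p unfolding y_def by (metis eq_iff_diff_eq_0)
    have orth: "cinner b y = 0" if "b \<in> B" for b
    proof -
      have "cinner b p = (\<Sum>c\<in>B. if b = c then cinner c x else 0)"
        unfolding p_def cinner_sum_right cinner_scaleC_right
        by (rule sum.cong) (use B that in \<open>auto simp: on_def\<close>)
      also have "\<dots> = cinner b x" using fin that by simp
      finally show ?thesis by (simp add: y_def cinner_diff_right)
    qed
    define u where "u = complex_of_real (inverse (norm y)) *\<^sub>C y"
    have u1: "cinner u u = 1"
      unfolding cinner_self u_def scaleC_of_real using \<open>y \<noteq> 0\<close> by simp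
    have bu: "cinner b u = 0" "cinner u b = 0" if "b \<in> B" for b
    proof -
      show "cinner b u = 0" using orth[OF that] by (simp add: u_def cinner_scaleC_right)
      then show "cinner u b = 0" using cinner_commute[of u b] by simp
    qed
    have "u \<notin> B" using u1 bu(1)[of u] by auto
    moreover have "on (insert u B)" using B u1 bu unfolding on_def by auto
    ultimately show False using max[of "insert u B"] fin by simp
  qed
  then have "cspan B = UNIV" by blast
  then have "orthonormal_basis B" using B fin unfolding orthonormal_basis_def on_def by blast
  then show ?thesis ..
qed

lemma orthonormal_basis_expansion:
  assumes "orthonormal_basis B"
  shows "x = (\<Sum>b\<in>B. cinner b x *\<^sub>C b)"
proof -
  have fin: "finite B" and on: "\<And>x y. x \<in> B \<Longrightarrow> y \<in> B \<Longrightarrow> cinner x y = (if x = y then 1 else 0)"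
    and "x \<in> cspan B"
    using assms by (auto simp: orthonormal_basis_def)
  then obtain c where x: "x = (\<Sum>b\<in>B. c b *\<^sub>C b)"
    by (auto simp: complex_vector.span_finite)
  have "cinner b x = c b" if "b \<in> B" for b
  proof -
    have "cinner b x = (\<Sum>a\<in>B. if b = a then c a else 0)"
      unfolding x cinner_sum_right cinner_scaleC_right
      by (rule sum.cong) (use on that in auto)
    then show ?thesis using fin that by simp
  qed
  then have "(\<Sum>b\<in>B. cinner b x *\<^sub>C b) = (\<Sum>b\<in>B. c b *\<^sub>C b)" by simp
  then show ?thesis using x by metis
qed

lemma op_trace_eq:
  fixes A :: "'a::{complex_inner, euclidean_space} \<Rightarrow>\<^sub>L 'a"
  assumes "complex_linear A" and B: "orthonormal_basis B"
  shows "op_trace A = (\<Sum>b\<in>B. cinner b (A b))"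
proof -
  define C :: "'a set" where "C = (SOME B. orthonormal_basis B)"
  have C: "orthonormal_basis C"
    unfolding C_def using ex_orthonormal_basis by (rule someI_ex)
  have A: "A (\<Sum>i\<in>I. f i *\<^sub>C g i) = (\<Sum>i\<in>I. f i *\<^sub>C A (g i))" for I :: "'a set" and f g
    using assms(1) by (simp add: blinfun.sum_right complex_linear_def)
  have "op_trace A = (\<Sum>c\<in>C. cinner c (A (\<Sum>b\<in>B. cinner b c *\<^sub>C b)))"
    unfolding op_trace_def C_def[symmetric] by (simp only: orthonormal_basis_expansion[OF B, symmetric])
  also have "\<dots> = (\<Sum>c\<in>C. \<Sum>b\<in>B. cinner b c * cinner c (A b))"
    by (simp add: A cinner_sum_right cinner_scaleC_right)
  also have "\<dots> = (\<Sum>b\<in>B. \<Sum>c\<in>C. cinner b c * cinner c (A b))"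
    by (rule sum.swap)
  also have "\<dots> = (\<Sum>b\<in>B. cinner b (\<Sum>c\<in>C. cinner c (A b) *\<^sub>C c))"
    by (simp add: cinner_sum_right cinner_scaleC_right mult.commute)
  also have "\<dots> = (\<Sum>b\<in>B. cinner b (A b))"
    by (simp only: orthonormal_basis_expansion[OF C, symmetric])
  finally show ?thesis .
qed

end

theory Submission
  imports Defs
begin

text \<open>
  Let \<open>\<rho>\<close> lie strictly between \<open>\<sigma>\<close> and \<open>\<tau>\<close> in \<open>C\<close>, and suppose that the three operators do not have
  the same eigenspaces; let \<open>r\<close> be the largest number at which their eigenspaces differ. On the
  orthogonal complement of the common eigenspaces above \<open>r\<close>, all three quadratic forms are at most
  \<open>r \<parallel>x\<parallel>\<^sup>2\<close>, with equality exactly on the \<open>r\<close>-eigenspace. For an \<open>r\<close>-eigenvector \<open>x\<close> of \<open>\<rho>\<close> the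
  average of the forms of \<open>\<sigma>\<close> and \<open>\<tau>\<close> attains the bound, so both do, and \<open>x\<close> is an \<open>r\<close>-eigenvector of
  \<open>\<sigma>\<close> and of \<open>\<tau>\<close>. By lexicographic maximality the \<open>r\<close>-eigenspaces of \<open>\<sigma>\<close> and \<open>\<tau>\<close> cannot have a larger
  dimension than that of \<open>\<rho>\<close>, so the three coincide, a contradiction. Hence \<open>\<sigma> = \<rho> = \<tau>\<close>.
\<close>

section \<open>Hermitian operators and the orthogonality of their eigenspaces\<close>

definition hermitian :: "('a::complex_inner \<Rightarrow>\<^sub>L 'a) \<Rightarrow> bool" where
  "hermitian A \<longleftrightarrow> complex_linear A \<and> (\<forall>x y. cinner x (A y) = cinner (A x) y)"

lemma hermitianD:
  assumes "hermitian A"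
  shows "A (c *\<^sub>C x) = c *\<^sub>C A x" "cinner x (A y) = cinner (A x) y"
  using assms by (auto simp: hermitian_def complex_linear_def)

text \<open>Polarisation: reality of the form at \<open>x + y\<close> and at
  \<open>x + \<i> *\<^sub>C y\<close> settles the imaginary and the real part of the symmetry,
  respectively.\<close>

lemma positive_semidefinite_imp_hermitian:
  assumes "complex_linear A" "positive_semidefinite A"
  shows "hermitian A"
proof -
  have im: "Im (cinner x (A x)) = 0" for x
    using assms(2) by (auto simp: positive_semidefinite_def complex_nonneg_Reals_iff)
  have lin: "A (c *\<^sub>C x) = c *\<^sub>C A x" for c x
    using assms(1) by (simp add: complex_linear_def)
  have "cinner x (A y) = cinner (A x) y" for x y
  proof -
    have 1: "Im (cinner x (A y)) + Im (cinner y (A x)) = 0"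
      using im[of "x + y"] im[of x] im[of y]
      by (simp add: blinfun.add_right cinner_add_left cinner_add_right)
    have 2: "Re (cinner x (A y)) = Re (cinner y (A x))"
      using im[of "x + \<i> *\<^sub>C y"] im[of x] im[of y]
      by (simp add: blinfun.add_right cinner_add_left cinner_add_right lin
          cinner_scaleC_left cinner_scaleC_right)
    have "cinner x (A y) = cnj (cinner y (A x))"
      using 1 2 by (simp add: complex_eq_iff)
    then show ?thesis using cinner_commute[of "A x" y] by simp
  qed
  then show ?thesis using assms(1) by (simp add: hermitian_def)
qed

lemma subspace_eigenspace:
  assumes "hermitian A"
  shows "complex_vector.subspace (eigenspace A c)"
  unfolding complex_vector.subspace_def eigenspace_def
  by (auto simp: blinfun.add_right hermitianD[OF assms] scaleC_add_right scaleC_scaleC mult.commute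
      blinfun.zero_right)

text \<open>Moving \<open>A\<close> across the inner product evaluates \<open>cinner x (A y)\<close>
  both as \<open>s\<close> times and, \<open>r\<close> being real, as \<open>r\<close> times
  \<open>cinner x y\<close>.\<close>

lemma eigenspaces_orthogonal:
  assumes "hermitian A" "x \<in> eigenspace A (complex_of_real r)" "y \<in> eigenspace A (complex_of_real s)"
    and "r \<noteq> s"
  shows "cinner x y = 0"
proof -
  have "complex_of_real s * cinner x y = cinner x (A y)"
    using assms(3) by (simp add: eigenspace_def cinner_scaleC_right)
  also have "\<dots> = complex_of_real r * cinner x y"
    using assms(2) by (simp add: hermitianD[OF assms(1)] eigenspace_def cinner_scaleC_left)
  finally show ?thesis using assms(4) by simp
qed


section \<open>Eigenbases\<close>

lemma linear_coeff_zero_if_quadratic_nonneg: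
  fixes a b :: real
  assumes "\<And>t. 0 \<le> 2 * t * a + t\<^sup>2 * b"
  shows "a = 0"
proof (rule ccontr)
  assume "a \<noteq> 0"
  \<comment> \<open>The minimiser of the quadratic after \<open>b\<close> is replaced by the larger,
    certainly positive \<open>\<bar>b\<bar> + 1\<close>.\<close>
  define t where "t = - a / (\<bar>b\<bar> + 1)"
  have "2 * t * a + t\<^sup>2 * b \<le> 2 * t * a + t\<^sup>2 * (\<bar>b\<bar> + 1)"
    by (simp add: mult_left_mono)
  also have "\<dots> = - (a\<^sup>2 / (\<bar>b\<bar> + 1))"
    unfolding t_def by (simp add: power2_eq_square divide_simps)
  also have "\<dots> < 0" using \<open>a \<noteq> 0\<close> by (simp add: divide_pos_pos)
  finally show False using assms[of t] by simp
qed

text \<open>A maximiser of the quadratic form on the unit sphere of \<open>V\<close> is an eigenvector.\<close>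

lemma symmetric_has_eigenvector:
  fixes A :: "'a::euclidean_space \<Rightarrow>\<^sub>L 'a"
  assumes V: "subspace V" and inv: "\<And>x. x \<in> V \<Longrightarrow> A x \<in> V"
    and sym: "\<And>x y. inner x (A y) = inner (A x) y"
    and ne: "y \<in> V" "y \<noteq> 0"
  obtains u m where "u \<in> V" "norm u = 1" "A u = m *\<^sub>R u"
proof -
  have "compact (sphere 0 1 \<inter> V)"
    by (intro compact_Int_closed compact_sphere closed_subspace V)
  moreover have "sphere 0 1 \<inter> V \<noteq> {}"
  proof -
    have "y /\<^sub>R norm y \<in> sphere 0 1 \<inter> V"
      using ne V by (simp add: subspace_scale)
    then show ?thesis by blast
  qed
  moreover have "continuous_on (sphere 0 1 \<inter> V) (\<lambda>x. inner x (A x))"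
    by (intro continuous_intros)
  ultimately obtain u where u: "u \<in> V" "norm u = 1"
    and max: "\<And>x. x \<in> V \<Longrightarrow> norm x = 1 \<Longrightarrow> inner x (A x) \<le> inner u (A u)"
    using continuous_attains_sup[of "sphere 0 1 \<inter> V" "\<lambda>x. inner x (A x)"] by fastforce
  define m where "m = inner u (A u)"
  have bound: "inner x (A x) \<le> m * (norm x)\<^sup>2" if "x \<in> V" for x
  proof (cases "x = 0")
    case False
    have "inner (x /\<^sub>R norm x) (A (x /\<^sub>R norm x)) \<le> m"
      unfolding m_def using that False V by (intro max) (auto simp: subspace_scale)
    then show ?thesis using False
      by (simp add: blinfun.scaleR_right power2_eq_square divide_simps mult.commute)
  qed simp
  \<comment> \<open>The residual of the eigenvector equation. Perturbing \<open>u\<close> along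
    \<open>w\<close> and using the bound gives a nonnegative quadratic in \<open>t\<close> whose
    linear coefficient is \<open>inner w w\<close> up to the factor 2, so \<open>w\<close>
    vanishes.\<close>
  define w where "w = m *\<^sub>R u - A u"
  have w: "w \<in> V" unfolding w_def using u inv V by (simp add: subspace_scale subspace_diff)
  have "0 \<le> 2 * t * inner w w + t\<^sup>2 * (m * (norm w)\<^sup>2 - inner w (A w))" for t
  proof -
    have "u + t *\<^sub>R w \<in> V" using u w V by (simp add: subspace_scale subspace_add)
    from bound[OF this] have "inner (u + t *\<^sub>R w) (A (u + t *\<^sub>R w)) \<le> m * inner (u + t *\<^sub>R w) (u + t *\<^sub>R w)"
      by (simp add: power2_norm_eq_inner)
    moreover have "inner u (A w) = inner w (A u)" using sym[of u w] by (simp add: inner_commute)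
    moreover have "inner w w = m * inner w u - inner w (A u)"
      by (subst (2) w_def) (simp add: inner_diff_right)
    moreover have "inner u u = 1" using u(2) by (simp add: norm_eq_1)
    ultimately show ?thesis
      by (simp add: blinfun.add_right blinfun.scaleR_right inner_add_left inner_add_right
          power2_norm_eq_inner inner_commute[of u w] m_def[symmetric])
        (simp add: algebra_simps power2_eq_square)
  qed
  then have "inner w w = 0" by (rule linear_coeff_zero_if_quadratic_nonneg)
  then have "A u = m *\<^sub>R u" by (simp add: w_def)
  then show ?thesis using that u by blast
qed

text \<open>Take an orthonormal set of eigenvectors of maximal cardinality. Its orthogonal
  complement is invariant, so if nonzero it would contain one more eigenvector.\<close>

lemma hermitian_eigenbasis:
  fixes A :: "'a::{complex_inner, euclidean_space} \<Rightarrow>\<^sub>L 'a"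
  assumes A: "hermitian A"
  obtains B and l :: "'a \<Rightarrow> real"
  where "orthonormal_basis B" "\<And>b. b \<in> B \<Longrightarrow> A b = complex_of_real (l b) *\<^sub>C b"
proof -
  define on where "on B \<longleftrightarrow> (\<forall>x\<in>B. \<forall>y\<in>B. cinner x y = (if x = y then 1 else 0)) \<and>
    (\<forall>b\<in>B. \<exists>r. A b = complex_of_real r *\<^sub>C b)" for B :: "'a set"
  have card: "finite B \<and> card B \<le> DIM('a)" if "on B" for B
  proof -
    have "pairwise orthogonal B"
      using that unfolding pairwise_def orthogonal_def on_def by (metis Re_cinner zero_complex.sel(1))
    moreover have "0 \<notin> B" using that unfolding on_def by (metis cinner_zero_right zero_neq_one)
    ultimately have "independent B" by (rule pairwise_orthogonal_independent)
    then show ?thesis by (rule independent_bound)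
  qed
  have "on {}" by (simp add: on_def)
  then obtain B where B: "on B" and max: "\<And>B'. on B' \<Longrightarrow> card B' \<le> card B"
    using ex_has_greatest_nat[of on "{}" card "Suc DIM('a)"] card le_imp_less_Suc by metis
  have fin: "finite B" using card[OF B] by simp
  define V where "V = {x. \<forall>b\<in>B. cinner b x = 0}"
  have V: "subspace V"
    unfolding subspace_def V_def
    by (auto simp: cinner_add_right cinner_scaleC_right simp flip: scaleC_of_real)
  have V0: "y = 0" if y: "y \<in> V" for y
  proof (rule ccontr)
    assume "y \<noteq> 0"
    have "A x \<in> V" if "x \<in> V" for x
      unfolding V_def
    proof safe
      fix b assume b: "b \<in> B"
      then obtain r where "A b = complex_of_real r *\<^sub>C b" using B unfolding on_def by blast
      then show "cinner b (A x) = 0"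
        using that b by (simp add: hermitianD[OF A] cinner_scaleC_left V_def)
    qed
    moreover have "inner x (A z) = inner (A x) z" for x z
      using hermitianD(2)[OF A, of x z] by (metis Re_cinner)
    \<comment> \<open>The eigenvector is found over the reals; its eigenvalue is real, so it is a
      complex eigenvector as well.\<close>
    ultimately obtain u m where u: "u \<in> V" "norm u = 1" "A u = m *\<^sub>R u"
      using symmetric_has_eigenvector[OF V _ _ y \<open>y \<noteq> 0\<close>] by metis
    have uu: "cinner u u = 1" using u by (simp add: cinner_self)
    have bu: "cinner b u = 0" "cinner u b = 0" if "b \<in> B" for b
      using u(1) that cinner_commute[of u b] by (auto simp: V_def)
    have "A u = complex_of_real m *\<^sub>C u" using u by (simp add: scaleC_of_real)
    then have "on (insert u B)" using B uu bu unfolding on_def by auto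
    moreover have "u \<notin> B" using uu bu(1)[of u] by auto
    ultimately show False using max[of "insert u B"] fin by simp
  qed
  have "x \<in> cspan B" for x
  proof -
    define p where "p = (\<Sum>b\<in>B. cinner b x *\<^sub>C b)"
    have p: "p \<in> cspan B"
      unfolding p_def
      by (rule complex_vector.span_sum, rule complex_vector.span_scale, rule complex_vector.span_base)
    have "cinner b (x - p) = 0" if "b \<in> B" for b
    proof -
      have "cinner b p = (\<Sum>c\<in>B. if b = c then cinner c x else 0)"
        unfolding p_def cinner_sum_right cinner_scaleC_right
        by (rule sum.cong) (use B that in \<open>auto simp: on_def\<close>)
      also have "\<dots> = cinner b x" using fin that by simp
      finally show ?thesis by (simp add: cinner_diff_right)
    qed
    then have "x - p = 0" by (intro V0) (simp add: V_def)
    then show ?thesis using p by simp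
  qed
  then have "orthonormal_basis B"
    using B fin unfolding orthonormal_basis_def on_def by blast
  moreover obtain l where "\<And>b. b \<in> B \<Longrightarrow> A b = complex_of_real (l b) *\<^sub>C b"
    using B unfolding on_def by metis
  ultimately show ?thesis using that by blast
qed

section \<open>Coordinates in an eigenbasis and bounds on the quadratic form\<close>

lemma cinner_eigenvector:
  assumes "hermitian A" "A b = complex_of_real r *\<^sub>C b"
  shows "cinner b (A x) = complex_of_real r * cinner b x"
  by (simp add: assms(2) hermitianD[OF assms(1)] cinner_scaleC_left)

lemma orthonormal_basis_eqI:
  assumes "orthonormal_basis B" "\<And>b. b \<in> B \<Longrightarrow> cinner b x = cinner b y"
  shows "x = y"
  using orthonormal_basis_expansion[OF assms(1), of x] orthonormal_basis_expansion[OF assms(1), of y]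
    assms(2) by simp

lemma cinner_orthonormal_basis:
  assumes "orthonormal_basis B"
  shows "cinner x y = (\<Sum>b\<in>B. cnj (cinner b x) * cinner b y)"
proof -
  have "cinner x y = cinner x (\<Sum>b\<in>B. cinner b y *\<^sub>C b)"
    by (simp only: orthonormal_basis_expansion[OF assms, symmetric])
  also have "\<dots> = (\<Sum>b\<in>B. cnj (cinner b x) * cinner b y)"
    unfolding cinner_sum_right cinner_scaleC_right
    by (rule sum.cong) (simp_all add: cinner_commute[of x])
  finally show ?thesis .
qed

text \<open>An eigenvector has a nonzero coordinate at some basis vector \<open>b\<close>; comparing
  this coordinate in the eigenvalue equation gives \<open>r = l b\<close>.\<close>

lemma finite_real_eigenvalues:
  fixes A :: "'a::{complex_inner, euclidean_space} \<Rightarrow>\<^sub>L 'a"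
  assumes A: "hermitian A"
  shows "finite (real_eigenvalues A)"
proof -
  obtain B l where B: "orthonormal_basis B" and l: "\<And>b. b \<in> B \<Longrightarrow> A b = complex_of_real (l b) *\<^sub>C b"
    using hermitian_eigenbasis[OF A] by metis
  have "real_eigenvalues A \<subseteq> l ` B"
  proof
    fix r assume "r \<in> real_eigenvalues A"
    then obtain x where x: "x \<noteq> 0" "A x = complex_of_real r *\<^sub>C x"
      by (auto simp: real_eigenvalues_def eigenspace_def)
    then obtain b where b: "b \<in> B" "cinner b x \<noteq> 0"
      using orthonormal_basis_eqI[OF B, of x 0] by auto
    have "complex_of_real (l b) * cinner b x = cinner b (A x)"
      by (rule cinner_eigenvector[OF A l[OF b(1)], symmetric])
    also have "\<dots> = complex_of_real r * cinner b x"
      by (simp add: x(2) cinner_scaleC_right)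
    finally have "complex_of_real (l b) * cinner b x = complex_of_real r * cinner b x" .
    with b have "l b = r" by simp
    with b show "r \<in> l ` B" by blast
  qed
  then show ?thesis using B finite_surj by (auto simp: orthonormal_basis_def)
qed

text \<open>In an eigenbasis, the gap between \<open>r * (norm x)\<^sup>2\<close> and the form is a
  weighted sum of squared coordinates with weights \<open>r - l b\<close>. Equality makes every term
  zero, leaving only coordinates with \<open>l b = r\<close>.\<close>

lemma quadratic_form_bound:
  fixes A :: "'a::{complex_inner, euclidean_space} \<Rightarrow>\<^sub>L 'a"
  assumes A: "hermitian A"
    and x: "\<And>s y. r < s \<Longrightarrow> y \<in> eigenspace A (complex_of_real s) \<Longrightarrow> cinner y x = 0"
  shows "inner x (A x) \<le> r * (norm x)\<^sup>2"
    and "inner x (A x) = r * (norm x)\<^sup>2 \<Longrightarrow> x \<in> eigenspace A (complex_of_real r)"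
proof -
  obtain B l where B: "orthonormal_basis B" and l: "\<And>b. b \<in> B \<Longrightarrow> A b = complex_of_real (l b) *\<^sub>C b"
    using hermitian_eigenbasis[OF A] by metis
  have fin: "finite B" using B by (simp add: orthonormal_basis_def)
  have "inner x (A x) = Re (\<Sum>b\<in>B. cnj (cinner b x) * (complex_of_real (l b) * cinner b x))"
    by (simp add: cinner_orthonormal_basis[OF B, of x "A x"] cinner_eigenvector[OF A l]
        flip: Re_cinner cong: sum.cong)
  also have "\<dots> = (\<Sum>b\<in>B. l b * (cmod (cinner b x))\<^sup>2)"
    unfolding Re_sum
    by (rule sum.cong) (simp_all add: cmod_power2, simp add: algebra_simps power2_eq_square)
  finally have form: "inner x (A x) = (\<Sum>b\<in>B. l b * (cmod (cinner b x))\<^sup>2)" .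
  have "(norm x)\<^sup>2 = Re (\<Sum>b\<in>B. cnj (cinner b x) * cinner b x)"
    by (simp add: power2_norm_eq_inner flip: Re_cinner cinner_orthonormal_basis[OF B])
  also have "\<dots> = (\<Sum>b\<in>B. (cmod (cinner b x))\<^sup>2)"
    unfolding Re_sum by (rule sum.cong) (simp_all add: cmod_power2, simp add: power2_eq_square)
  finally have gap: "r * (norm x)\<^sup>2 - inner x (A x) = (\<Sum>b\<in>B. (r - l b) * (cmod (cinner b x))\<^sup>2)"
    by (simp add: form sum_distrib_left left_diff_distrib sum_subtractf)
  \<comment> \<open>A negative weight means \<open>r < l b\<close>; then \<open>b\<close> is itself
    an eigenvector above \<open>r\<close>, and its coordinate vanishes by hypothesis.\<close>
  have nonneg: "0 \<le> (r - l b) * (cmod (cinner b x))\<^sup>2" if "b \<in> B" for b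
    using x[of "l b" b] l[OF that] by (cases "r < l b") (auto simp: eigenspace_def)
  show "inner x (A x) \<le> r * (norm x)\<^sup>2"
    using sum_nonneg[of B "\<lambda>b. (r - l b) * (cmod (cinner b x))\<^sup>2"] nonneg by (simp flip: gap)
  assume "inner x (A x) = r * (norm x)\<^sup>2"
  then have "(\<Sum>b\<in>B. (r - l b) * (cmod (cinner b x))\<^sup>2) = 0" by (simp flip: gap)
  then have "(r - l b) * (cmod (cinner b x))\<^sup>2 = 0" if "b \<in> B" for b
    using sum_nonneg_eq_0_iff[OF fin, of "\<lambda>b. (r - l b) * (cmod (cinner b x))\<^sup>2"] nonneg that by blast
  then have "A x = complex_of_real r *\<^sub>C x"
    by (intro orthonormal_basis_eqI[OF B])
      (auto simp: cinner_eigenvector[OF A l] cinner_scaleC_right)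
  then show "x \<in> eigenspace A (complex_of_real r)" by (simp add: eigenspace_def)
qed

text \<open>An eigenbasis of \<open>A\<close> is one of \<open>A'\<close> with the same
  eigenvalues.\<close>

lemma eq_if_eigenspaces_subset:
  fixes A A' :: "'a::{complex_inner, euclidean_space} \<Rightarrow>\<^sub>L 'a"
  assumes A: "hermitian A" and A': "hermitian A'"
    and sub: "\<And>r. eigenspace A (complex_of_real r) \<subseteq> eigenspace A' (complex_of_real r)"
  shows "A = A'"
proof (rule blinfun_eqI)
  fix x
  obtain B l where B: "orthonormal_basis B" and l: "\<And>b. b \<in> B \<Longrightarrow> A b = complex_of_real (l b) *\<^sub>C b"
    using hermitian_eigenbasis[OF A] by metis
  have "A' b = complex_of_real (l b) *\<^sub>C b" if "b \<in> B" for b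
    using sub[of "l b"] l[OF that] by (auto simp: eigenspace_def)
  then have "cinner b (A x) = cinner b (A' x)" if "b \<in> B" for b
    using that by (simp only: cinner_eigenvector[OF A l] cinner_eigenvector[OF A'])
  then show "A x = A' x" by (rule orthonormal_basis_eqI[OF B])
qed


section \<open>Spectra and eigenspace dimensions\<close>

text \<open>A basis of \<open>S\<close> extends to one of \<open>T\<close>, and the dimension bound
  leaves no room for new vectors.\<close>

lemma csubspace_dim_equal:
  fixes S T :: "'a::{complex_inner, euclidean_space} set"
  assumes S: "complex_vector.subspace S" and "S \<subseteq> T" and "cdim T \<le> cdim S"
  shows "S = T"
proof -
  \<comment> \<open>A finite spanning set of the whole space, which makes \<open>E\<close> finite so
    that cardinalities can be compared.\<close>
  obtain U :: "'a set" where "orthonormal_basis U" using ex_orthonormal_basis by blast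
  then have U: "finite U" "cspan U = UNIV" by (auto simp: orthonormal_basis_def)
  obtain D where D: "D \<subseteq> S" "complex_vector.independent D" "S \<subseteq> cspan D" "card D = cdim S"
    using complex_vector.basis_exists by metis
  obtain E where E: "D \<subseteq> E" "E \<subseteq> T" "complex_vector.independent E" "T \<subseteq> cspan E"
    using complex_vector.maximal_independent_subset_extend[of D T] D \<open>S \<subseteq> T\<close> by blast
  have "finite E" using complex_vector.independent_span_bound[OF U(1) E(3)] U(2) by auto
  moreover have "card E = cdim T"
    using complex_vector.dim_unique[OF E(2,4,3) refl] by simp
  ultimately have "D = E" using E(1) D(4) assms(3) by (simp add: card_seteq)
  then have "T \<subseteq> S" using E(4) complex_vector.span_minimal[OF D(1) S] by blast
  then show ?thesis using \<open>S \<subseteq> T\<close> by blast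
qed

text \<open>Padding the set of eigenvalues lets the spectra of two operators be compared along one list.\<close>

lemma Spec_superset:
  assumes "finite S" "real_eigenvalues A \<subseteq> S"
  shows "Spec A = concat (map (\<lambda>r. replicate (cdim (eigenspace A (complex_of_real r))) r)
    (rev (sorted_list_of_set S)))"
proof -
  let ?f = "\<lambda>r. replicate (cdim (eigenspace A (complex_of_real r))) r"
  have "?f r = []" if "r \<notin> real_eigenvalues A" for r
  proof -
    have "eigenspace A (complex_of_real r) \<subseteq> {0}" using that by (auto simp: real_eigenvalues_def)
    then have "cdim (eigenspace A (complex_of_real r)) = 0"
      using complex_vector.dim_unique[of "{}" "eigenspace A (complex_of_real r)" 0]
      by (simp add: complex_vector.span_empty complex_vector.independent_empty)
    then show ?thesis by simp
  qed
  then have pad: "concat (map ?f xs) = concat (map ?f (filter (\<lambda>r. r \<in> real_eigenvalues A) xs))" for xs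
    by (induction xs) auto
  have "filter (\<lambda>r. r \<in> real_eigenvalues A) (sorted_list_of_set S) =
      sorted_list_of_set (real_eigenvalues A)"
    using assms finite_subset[OF assms(2,1)]
    by (intro sorted_distinct_set_unique) (auto simp: sorted_wrt_filter)
  then show ?thesis
    unfolding Spec_def by (subst pad) (simp only: rev_filter[symmetric])
qed

text \<open>The spectra agree through all entries above \<open>r\<close>; then
  \<open>Spec A'\<close> runs out of copies of \<open>r\<close> while \<open>Spec A\<close> still
  has one.\<close>

lemma not_Spec_lex_le:
  assumes fin: "finite (real_eigenvalues A)" "finite (real_eigenvalues A')"
    and eq: "\<And>s. r < s \<Longrightarrow> eigenspace A (complex_of_real s) = eigenspace A' (complex_of_real s)"
    and less: "cdim (eigenspace A' (complex_of_real r)) < cdim (eigenspace A (complex_of_real r))"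
  shows "\<not> Spec A \<le>\<^sub>l\<^sub>e\<^sub>x Spec A'"
proof
  let ?f = "\<lambda>A r. replicate (cdim (eigenspace A (complex_of_real r))) r"
  assume le: "Spec A \<le>\<^sub>l\<^sub>e\<^sub>x Spec A'"
  define S where "S = insert r (real_eigenvalues A \<union> real_eigenvalues A')"
  have S: "finite S" "r \<in> S" using fin by (auto simp: S_def)
  have Spec: "Spec A = concat (map (?f A) (rev (sorted_list_of_set S)))"
    "Spec A' = concat (map (?f A') (rev (sorted_list_of_set S)))"
    by (rule Spec_superset[OF S(1)]; auto simp: S_def)+
  have "r \<in> set (rev (sorted_list_of_set S))" using S by simp
  then obtain xs ys where split: "rev (sorted_list_of_set S) = xs @ r # ys"
    by (meson split_list)
  have "sorted_wrt (>) (rev (sorted_list_of_set S))"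
    by (simp add: sorted_wrt_rev)
  then have xs: "\<forall>x\<in>set xs. r < x" and ys: "\<forall>y\<in>set ys. y < r"
    unfolding split by (auto simp: sorted_wrt_append)
  have xs_eq: "map (?f A) xs = map (?f A') xs" using xs eq by simp
  obtain k where k: "cdim (eigenspace A (complex_of_real r)) =
      cdim (eigenspace A' (complex_of_real r)) + Suc k"
    using less less_iff_Suc_add by auto
  define us vs where "us = replicate k r @ concat (map (?f A) ys)" and "vs = concat (map (?f A') ys)"
  \<comment> \<open>The common prefix: the blocks above \<open>r\<close> and the shorter of the two
    blocks of \<open>r\<close>.\<close>
  define ps where "ps = concat (map (?f A') xs) @ ?f A' r"
  have "Spec A = ps @ r # us" "Spec A' = ps @ vs"
    unfolding Spec split ps_def us_def vs_def by (simp_all add: xs_eq k replicate_add replicate_app_Cons_same)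
  with le have "r # us = vs \<or> (r # us, vs) \<in> lex {(a, b). a < b}"
    unfolding lex_le_def by (simp add: lex_append_left_iff)
  \<comment> \<open>An empty \<open>vs\<close> is excluded: it is not equal to
    \<open>r # us\<close>, and \<open>lex\<close> relates only lists of equal length.\<close>
  then obtain v vs' where v: "vs = v # vs'" "r \<le> v"
    by (cases vs) auto
  moreover have "\<forall>v\<in>set vs. v < r" using ys by (auto simp: vs_def)
  ultimately show False by auto
qed

section \<open>From lexicographic maximality to extremality\<close>

theorem theorem3p10:
  fixes C :: "('a::{complex_inner, euclidean_space} \<Rightarrow>\<^sub>L 'a) set"
    and \<rho> :: "'a \<Rightarrow>\<^sub>L 'a"
  assumes "C \<subseteq> density_operators"
    and "convex C"
    and "\<rho> \<in> C"
    and "\<And>\<sigma>. \<sigma> \<in> C \<Longrightarrow> Spec \<sigma> \<le>\<^sub>l\<^sub>e\<^sub>x Spec \<rho>"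
  shows "\<rho> extreme_point_of C"
proof -
  let ?E = "\<lambda>A r. eigenspace A (complex_of_real r)"
  have herm: "hermitian A" if "A \<in> C" for A
    using assms(1) that positive_semidefinite_imp_hermitian by (auto simp: density_operators_def)
  have "\<rho> \<notin> open_segment \<sigma> \<tau>" if C: "\<sigma> \<in> C" "\<tau> \<in> C" for \<sigma> \<tau>
  proof
    assume "\<rho> \<in> open_segment \<sigma> \<tau>"
    then obtain t where "\<sigma> \<noteq> \<tau>" and t: "0 < t" "t < 1" and \<rho>: "\<rho> = (1 - t) *\<^sub>R \<sigma> + t *\<^sub>R \<tau>"
      by (auto simp: in_segment)
    define Bad where "Bad = {r. ?E \<sigma> r \<noteq> ?E \<rho> r \<or> ?E \<tau> r \<noteq> ?E \<rho> r}"
    have "Bad = {}"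
    proof (rule ccontr)
      assume "Bad \<noteq> {}"
      \<comment> \<open>Where none of the three operators has an eigenvalue, all three eigenspaces
        are zero. So \<open>Bad\<close> is finite and has a maximum.\<close>
      have "Bad \<subseteq> real_eigenvalues \<rho> \<union> real_eigenvalues \<sigma> \<union> real_eigenvalues \<tau>"
      proof
        fix r assume "r \<in> Bad"
        moreover have "?E A r = {0}" if "r \<notin> real_eigenvalues A" for A :: "'a \<Rightarrow>\<^sub>L 'a"
          using that by (auto simp: real_eigenvalues_def eigenspace_def blinfun.zero_right)
        ultimately show "r \<in> real_eigenvalues \<rho> \<union> real_eigenvalues \<sigma> \<union> real_eigenvalues \<tau>"
          unfolding Bad_def by auto
      qed
      then have fin: "finite Bad"
        by (rule finite_subset) (use finite_real_eigenvalues herm C assms(3) in auto)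
      define r where "r = Max Bad"
      have "r \<in> Bad" unfolding r_def using fin \<open>Bad \<noteq> {}\<close> by (rule Max_in)
      have above: "?E \<sigma> s = ?E \<rho> s" "?E \<tau> s = ?E \<rho> s" if "r < s" for s
        using that Max_ge[OF fin, of s] unfolding r_def Bad_def by force+
      have sub: "?E \<rho> r \<subseteq> ?E \<sigma> r \<inter> ?E \<tau> r"
      proof
        fix x assume x: "x \<in> ?E \<rho> r"
        \<comment> \<open>Above \<open>r\<close> the eigenspaces of \<sigma> and \<tau> are those of
          \<rho>, so this orthogonality gives the quadratic bound for both endpoints.\<close>
        have orth: "cinner y x = 0" if "r < s" "y \<in> ?E \<rho> s" for s y
          using eigenspaces_orthogonal[OF herm[OF assms(3)] that(2) x] that(1) by simp
        have \<sigma>: "inner x (\<sigma> x) \<le> r * (norm x)\<^sup>2"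
          "inner x (\<sigma> x) = r * (norm x)\<^sup>2 \<Longrightarrow> x \<in> ?E \<sigma> r"
          by (rule quadratic_form_bound[OF herm[OF C(1)]]; use above orth in blast)+
        have \<tau>: "inner x (\<tau> x) \<le> r * (norm x)\<^sup>2"
          "inner x (\<tau> x) = r * (norm x)\<^sup>2 \<Longrightarrow> x \<in> ?E \<tau> r"
          by (rule quadratic_form_bound[OF herm[OF C(2)]]; use above orth in blast)+
        have "(1 - t) * inner x (\<sigma> x) + t * inner x (\<tau> x) = inner x (\<rho> x)"
          by (simp add: \<rho> blinfun.add_left blinfun.scaleR_left inner_add_right)
        also have "\<dots> = r * (norm x)\<^sup>2"
          using x by (simp add: eigenspace_def scaleC_of_real power2_norm_eq_inner)
        finally have sum: "(1 - t) * (r * (norm x)\<^sup>2 - inner x (\<sigma> x)) +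
            t * (r * (norm x)\<^sup>2 - inner x (\<tau> x)) = 0"
          by (simp add: algebra_simps)
        \<comment> \<open>Two nonnegative gaps with positive weights sum to zero, so each is
          zero.\<close>
        have "inner x (\<sigma> x) = r * (norm x)\<^sup>2 \<and> inner x (\<tau> x) = r * (norm x)\<^sup>2"
          using sum t \<sigma>(1) \<tau>(1) by (subst (asm) add_nonneg_eq_0_iff) auto
        then show "x \<in> ?E \<sigma> r \<inter> ?E \<tau> r" using \<sigma>(2) \<tau>(2) by blast
      qed
      \<comment> \<open>Here \<sigma> is a fresh variable, to be instantiated with both endpoints. A
        strictly larger eigenspace at \<open>r\<close> would contradict the maximality of
        \<open>Spec \<rho>\<close>.\<close>
      have "?E \<sigma> r = ?E \<rho> r" if \<sigma>: "\<sigma> \<in> C" and "?E \<rho> r \<subseteq> ?E \<sigma> r" 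
        and "\<And>s. r < s \<Longrightarrow> ?E \<sigma> s = ?E \<rho> s" for \<sigma>
      proof -
        have "cdim (?E \<sigma> r) \<le> cdim (?E \<rho> r)"
          using not_Spec_lex_le[of \<sigma> \<rho> r] that assms(3,4) finite_real_eigenvalues herm
          by (meson linorder_not_less)
        then show ?thesis
          using csubspace_dim_equal[OF subspace_eigenspace] herm assms(3) that(2) by metis
      qed
      with sub above C \<open>r \<in> Bad\<close> show False by (auto simp: Bad_def)
    qed
    then have "\<rho> = \<sigma>" "\<rho> = \<tau>"
      using eq_if_eigenspaces_subset[of \<rho>] herm C assms(3) by (auto simp: Bad_def)
    with \<open>\<sigma> \<noteq> \<tau>\<close> show False by simp
  qed
  then show ?thesis using assms(3) by (simp add: extreme_point_of_def)
qed

end
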